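(* Let $K\subset\mathbb R^d$ be a pointed rational polyhedral cone with non-empty interior, let $B$ be its Hilbert basis, and let $\bar B=B\cup\{0\}$. Let $\{F_1,\dots,F_M\}$ ($M\ge1$) be an antichain of faces of $K$, and for each $i$ let $\mathbf b^*_{F_i}=\sum_{\mathbf b\in B\cap F_i}\mathbf b$. Define $$A=\{2\mathbf b:\mathbf b\in B\}\cup\{2\mathbf b^*_{F_i}+\mathbf b:\ 1\le i\le M,\ \mathbf b\in\bar B\}.$$ Then (i) $\mathrm{cone}(A)=K$; (ii) the saturation of the semigroup $Q(A)$ generated by $A$ (the set of points of $\mathrm{cone}(A)$ lying in the lattice generated by $A$) is $K\cap\mathbb Z^d$; (iii) the minimal almost saturated faces of $K$ for $Q(A)$ are exactly $F_1,\dots,F_M$.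
   Context: The Hilbert basis $B$ of $K$ is the unique minimal finite subset of $K\cap\mathbb Z^d$ generating $K\cap\mathbb Z^d$ as a semigroup. An antichain of faces is a set of faces of $K$ no one of which is contained in another. $Q(A)=\{\sum_{\mathbf a\in A}\lambda_{\mathbf a}\mathbf a:\lambda_{\mathbf a}\in\mathbb N\}$. With $Q_{\rm sat}=K\cap\mathbb Z^d$, a point $\mathbf a\in Q(A)$ is a saturation point of $Q(A)$ if $\mathbf a+Q_{\rm sat}\subset Q(A)$. A face $F$ of $K$ is almost saturated (for $Q(A)$) if it contains a saturation point of $Q(A)$; it is a minimal almost saturated face if it is almost saturated and no face $G\subsetneq F$ of $K$ is almost saturated. *)

theory Defs
  imports "HOL-Analysis.Analysis"
begin

definition int_points :: "(real ^ 'n) set" where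
  "int_points = {x. \<forall>i. x $ i \<in> \<int>}"

definition rational_polyhedral_cone :: "(real ^ 'n) set \<Rightarrow> bool" where
  "rational_polyhedral_cone K \<longleftrightarrow>
     (\<exists>V. finite V \<and> (\<forall>v\<in>V. \<forall>i. v $ i \<in> \<rat>) \<and> K = convex_cone hull V)"

definition pointed_cone :: "(real ^ 'n) set \<Rightarrow> bool" where
  "pointed_cone K \<longleftrightarrow> K \<inter> uminus ` K = {0}"

text \<open>The next two are meant for finite \<open>A\<close>; a sum over an infinite set is \<open>0\<close>.
  Zero coefficients are allowed, so \<open>0\<close> always lies in \<open>semigroup_gen A\<close>.\<close>

definition semigroup_gen :: "(real ^ 'n) set \<Rightarrow> (real ^ 'n) set" where
  "semigroup_gen A = {x. \<exists>c :: real ^ 'n \<Rightarrow> nat. x = (\<Sum>a\<in>A. real (c a) *\<^sub>R a)}"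

definition lattice_gen :: "(real ^ 'n) set \<Rightarrow> (real ^ 'n) set" where
  "lattice_gen A = {x. \<exists>c :: real ^ 'n \<Rightarrow> int. x = (\<Sum>a\<in>A. real_of_int (c a) *\<^sub>R a)}"

definition semigroup_saturation :: "(real ^ 'n) set \<Rightarrow> (real ^ 'n) set" where
  "semigroup_saturation A = convex_cone hull A \<inter> lattice_gen A"

text \<open>Minimality is with respect to inclusion. For a pointed rational polyhedral cone such a
  set \<open>B\<close> exists and is unique.\<close>

definition is_hilbert_basis :: "(real ^ 'n) set \<Rightarrow> (real ^ 'n) set \<Rightarrow> bool" where
  "is_hilbert_basis K B \<longleftrightarrow>
     finite B \<and> B \<subseteq> K \<inter> int_points \<and> semigroup_gen B = K \<inter> int_points \<and>
     (\<forall>C. C \<subset> B \<longrightarrow> semigroup_gen C \<noteq> K \<inter> int_points)"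

text \<open>The library's \<open>face_of\<close> admits the empty set, which is not a face of a cone here;
  \<open>K\<close> itself is a face, and \<open>{0}\<close> is one if \<open>K\<close> is pointed.\<close>

definition cone_face :: "(real ^ 'n) set \<Rightarrow> (real ^ 'n) set \<Rightarrow> bool" where
  "cone_face K F \<longleftrightarrow> F face_of K \<and> F \<noteq> {}"

definition antichain_of_faces :: "(real ^ 'n) set \<Rightarrow> (real ^ 'n) set set \<Rightarrow> bool" where
  "antichain_of_faces K \<F> \<longleftrightarrow>
     (\<forall>F\<in>\<F>. cone_face K F) \<and> (\<forall>F\<in>\<F>. \<forall>G\<in>\<F>. F \<subseteq> G \<longrightarrow> F = G)"

definition saturation_point :: "(real ^ 'n) set \<Rightarrow> (real ^ 'n) set \<Rightarrow> real ^ 'n \<Rightarrow> bool" where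
  "saturation_point K A a \<longleftrightarrow>
     a \<in> semigroup_gen A \<and> (\<forall>q \<in> K \<inter> int_points. a + q \<in> semigroup_gen A)"

definition almost_saturated :: "(real ^ 'n) set \<Rightarrow> (real ^ 'n) set \<Rightarrow> (real ^ 'n) set \<Rightarrow> bool" where
  "almost_saturated K A F \<longleftrightarrow> cone_face K F \<and> (\<exists>a\<in>F. saturation_point K A a)"

definition minimal_almost_saturated ::
    "(real ^ 'n) set \<Rightarrow> (real ^ 'n) set \<Rightarrow> (real ^ 'n) set \<Rightarrow> bool" where
  "minimal_almost_saturated K A F \<longleftrightarrow>
     almost_saturated K A F \<and> (\<forall>G. cone_face K G \<and> G \<subset> F \<longrightarrow> \<not> almost_saturated K A G)"

end

theory Submission
  imports Defs
begin

text \<open>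
  An integer point of \<open>K\<close> is \<open>\<Sum>n\<^sub>b b\<close>, and only the parities of the \<open>n\<^sub>b\<close> obstruct membership in
  the semigroup of \<open>A\<close>. Adding \<open>2 b\<^sup>*\<^sub>i\<close> once for each \<open>b \<in> B\<close> allows every odd \<open>b\<close> to be absorbed into
  a generator \<open>2 b\<^sup>*\<^sub>i + b\<close>, so \<open>2 |B| b\<^sup>*\<^sub>i\<close> is a saturation point in \<open>F\<^sub>i\<close>. Conversely, a face \<open>G\<close> that
  contains a generator \<open>2 b\<^sup>*\<^sub>i + b\<close> contains \<open>F\<^sub>i\<close>. If \<open>G\<close> contains no \<open>F\<^sub>i\<close>, then all elements of
  the semigroup in \<open>G\<close> are twice an integer point of \<open>K\<close>. If moreover \<open>a \<in> G\<close> is a saturation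
  point and \<open>b \<in> B \<inter> G\<close>, then \<open>a\<close> and \<open>a + b\<close> are both such doubles, which contradicts the
  irreducibility of \<open>b\<close>. The face \<open>{0}\<close> has no such \<open>b\<close>; there \<open>0\<close> would be the saturation
  point, although every nonzero element of the semigroup is reducible.
\<close>

section \<open>Closure of additive sets under sums and natural multiples\<close>

text \<open>No finiteness is assumed on \<open>I\<close>: a sum over an infinite set is
  \<open>0\<close>, which lies in \<open>S\<close> as well.\<close>

lemma sum_closed:
  assumes "0 \<in> S" and "\<And>x y. x \<in> S \<Longrightarrow> y \<in> S \<Longrightarrow> x + y \<in> S"
    and "\<And>i. i \<in> I \<Longrightarrow> f i \<in> S"
  shows "sum f I \<in> S"
  using assms(3) by (induction I rule: infinite_finite_induct) (auto simp: assms(1,2))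

lemma scaleR_of_nat_closed:
  fixes x :: "'a :: real_vector"
  assumes "0 \<in> S" and "\<And>x y. x \<in> S \<Longrightarrow> y \<in> S \<Longrightarrow> x + y \<in> S" and "x \<in> S"
  shows "real n *\<^sub>R x \<in> S"
  by (induction n) (auto simp: assms scaleR_add_left)

section \<open>Semigroups and lattices generated by finite sets\<close>

lemma semigroup_genI:
  fixes c :: "_ \<Rightarrow> nat"
  shows "x = (\<Sum>a\<in>A. real (c a) *\<^sub>R a) \<Longrightarrow> x \<in> semigroup_gen A"
  unfolding semigroup_gen_def by (rule CollectI, rule exI)

lemma lattice_genI:
  fixes c :: "_ \<Rightarrow> int"
  shows "x = (\<Sum>a\<in>A. of_int (c a) *\<^sub>R a) \<Longrightarrow> x \<in> lattice_gen A"
  unfolding lattice_gen_def by (rule CollectI, rule exI)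

lemma zero_in_semigroup_gen: "0 \<in> semigroup_gen A"
  unfolding semigroup_gen_def by (auto intro: exI[of _ "\<lambda>_. 0"])

lemma semigroup_gen_add:
  assumes "x \<in> semigroup_gen A" "y \<in> semigroup_gen A"
  shows "x + y \<in> semigroup_gen A"
proof -
  from assms obtain c d :: "_ \<Rightarrow> nat" where
    "x = (\<Sum>a\<in>A. real (c a) *\<^sub>R a)" "y = (\<Sum>a\<in>A. real (d a) *\<^sub>R a)"
    unfolding semigroup_gen_def by auto
  then have "x + y = (\<Sum>a\<in>A. real (c a + d a) *\<^sub>R a)"
    by (simp add: sum.distrib scaleR_add_left)
  then show ?thesis
    by (rule semigroup_genI)
qed

lemma semigroup_gen_inc:
  assumes "finite A" "a \<in> A"
  shows "a \<in> semigroup_gen A"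
proof -
  have "a = (\<Sum>x\<in>A. if x = a then a else 0)"
    using assms by simp
  also have "\<dots> = (\<Sum>x\<in>A. real (if x = a then 1 else 0) *\<^sub>R x)"
    by (rule sum.cong) auto
  finally show ?thesis
    by (rule semigroup_genI)
qed

lemma semigroup_gen_subset:
  assumes "A \<subseteq> S" "0 \<in> S" "\<And>x y. x \<in> S \<Longrightarrow> y \<in> S \<Longrightarrow> x + y \<in> S"
  shows "semigroup_gen A \<subseteq> S"
proof
  fix x assume "x \<in> semigroup_gen A"
  then obtain c :: "_ \<Rightarrow> nat" where x: "x = (\<Sum>a\<in>A. real (c a) *\<^sub>R a)"
    unfolding semigroup_gen_def by auto
  show "x \<in> S"
    unfolding x using assms by (intro sum_closed scaleR_of_nat_closed) auto
qed

lemma lattice_gen_diff: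
  assumes "x \<in> lattice_gen A" "y \<in> lattice_gen A"
  shows "x - y \<in> lattice_gen A"
proof -
  from assms obtain c d :: "_ \<Rightarrow> int" where
    "x = (\<Sum>a\<in>A. of_int (c a) *\<^sub>R a)" "y = (\<Sum>a\<in>A. of_int (d a) *\<^sub>R a)"
    unfolding lattice_gen_def by auto
  then have "x - y = (\<Sum>a\<in>A. of_int (c a - d a) *\<^sub>R a)"
    by (simp add: sum_subtractf scaleR_diff_left)
  then show ?thesis
    by (rule lattice_genI)
qed

lemma semigroup_gen_subset_lattice_gen: "semigroup_gen A \<subseteq> lattice_gen A"
proof
  fix x assume "x \<in> semigroup_gen A"
  then obtain c :: "_ \<Rightarrow> nat" where "x = (\<Sum>a\<in>A. of_int (int (c a)) *\<^sub>R a)"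
    unfolding semigroup_gen_def by auto
  then show "x \<in> lattice_gen A"
    by (rule lattice_genI)
qed

lemma lattice_gen_add:
  assumes "x \<in> lattice_gen A" "y \<in> lattice_gen A"
  shows "x + y \<in> lattice_gen A"
proof -
  have "0 \<in> lattice_gen A"
    using zero_in_semigroup_gen semigroup_gen_subset_lattice_gen by blast
  then have "x - (0 - y) \<in> lattice_gen A"
    using assms by (blast intro: lattice_gen_diff)
  then show ?thesis by simp
qed

section \<open>Integer points as an additive group\<close>

lemma zero_in_int_points: "0 \<in> int_points"
  by (simp add: int_points_def)

lemma int_points_add: "x \<in> int_points \<Longrightarrow> y \<in> int_points \<Longrightarrow> x + y \<in> int_points"
  by (simp add: int_points_def)

lemma lattice_gen_subset_int_points:
  assumes "A \<subseteq> int_points"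
  shows "lattice_gen A \<subseteq> int_points"
proof
  fix x assume "x \<in> lattice_gen A"
  then obtain c :: "_ \<Rightarrow> int" where x: "x = (\<Sum>a\<in>A. of_int (c a) *\<^sub>R a)"
    unfolding lattice_gen_def by auto
  have "of_int (c a) *\<^sub>R a \<in> int_points" if "a \<in> A" for a
    using that assms by (auto simp: int_points_def)
  then show "x \<in> int_points"
    unfolding x by (intro sum_closed) (auto simp: zero_in_int_points int_points_add)
qed

section \<open>Faces of convex cones\<close>

lemma cone_face_convex_cone:
  assumes "convex_cone K" "cone_face K F"
  shows "convex_cone F"
  using assms face_of_conic face_of_imp_convex
  unfolding cone_face_def convex_cone_def by blast

text \<open>Turns the segment condition of \<open>face_of\<close> into the additive form used for
  semigroups: up to scaling, a sum is a midpoint.\<close>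

lemma cone_face_add:
  assumes K: "convex_cone K" and F: "cone_face K F"
    and x: "x \<in> K" and y: "y \<in> K" and xy: "x + y \<in> F"
  shows "x \<in> F"
proof -
  have cF: "convex_cone F"
    using K F by (rule cone_face_convex_cone)
  have "2 *\<^sub>R x \<in> F"
  \<comment> \<open>The open segment between equal points is empty, so this case cannot come from
    the face property.\<close>
  proof (cases "x = y")
    case True
    then show ?thesis using xy by (simp add: scaleR_2)
  next
    case False
    \<comment> \<open>The endpoints are doubled so that their midpoint is exactly
      \<open>x + y\<close>.\<close>
    have "x + y = (1 - 1/2) *\<^sub>R (2 *\<^sub>R x) + (1/2) *\<^sub>R (2 *\<^sub>R y)"
      by simp
    then have "x + y \<in> open_segment (2 *\<^sub>R x) (2 *\<^sub>R y)"
      using False unfolding in_segment by (intro conjI exI[of _ "1/2"]) auto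
    moreover have "2 *\<^sub>R x \<in> K" "2 *\<^sub>R y \<in> K"
      using K x y by (auto intro: convex_cone_scaleR)
    ultimately show ?thesis
      using F xy face_ofD unfolding cone_face_def by blast
  qed
  then show ?thesis
    using convex_cone_scaleR[OF cF, of "1/2" "2 *\<^sub>R x"] by simp
qed

lemma cone_face_sum:
  assumes K: "convex_cone K" and F: "cone_face K F" and I: "finite I" "i \<in> I"
    and f: "\<And>i. i \<in> I \<Longrightarrow> f i \<in> K" and s: "sum f I \<in> F"
  shows "f i \<in> F"
proof (rule cone_face_add[OF K F])
  show "f i \<in> K" using f I by blast
  show "sum f (I - {i}) \<in> K"
    using f K by (intro sum_closed) (auto intro: convex_cone_add convex_cone_contains_0)
  show "f i + sum f (I - {i}) \<in> F"
    using s I by (simp add: sum.remove)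
qed

lemma cone_face_scaleR:
  assumes K: "convex_cone K" and F: "cone_face K F" and c: "c > 0" and x: "c *\<^sub>R x \<in> F"
  shows "x \<in> F"
  using convex_cone_scaleR[OF cone_face_convex_cone[OF K F], of "inverse c" "c *\<^sub>R x"] c x by simp

text \<open>Induction over the hull: in any conic combination that lands in \<open>F\<close>, the
  face property forces every generator with a positive coefficient into \<open>F\<close>.\<close>

lemma cone_face_hull:
  assumes F: "cone_face (convex_cone hull B) F"
  shows "F \<subseteq> convex_cone hull (B \<inter> F)"
proof -
  let ?K = "convex_cone hull B"
  \<comment> \<open>The implication makes this set a convex cone containing all of \<open>B\<close>,
    including the generators outside \<open>F\<close>.\<close>
  let ?S = "{x \<in> ?K. x \<in> F \<longrightarrow> x \<in> convex_cone hull (B \<inter> F)}"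
  have K: "convex_cone ?K"
    by (rule convex_cone_convex_cone_hull)
  have "?K \<subseteq> ?S"
  proof (rule hull_minimal)
    show "B \<subseteq> ?S"
      by (auto intro: hull_inc)
    show "convex_cone ?S"
    proof (rule convex_cone_iff[THEN iffD2], intro conjI ballI allI impI)
      show "0 \<in> ?S"
        by (simp add: convex_cone_hull_contains_0)
    next
      fix x y assume xy: "x \<in> ?S" "y \<in> ?S"
      then have "x \<in> F \<and> y \<in> F" if "x + y \<in> F"
        using that cone_face_add[OF K F, of x y] cone_face_add[OF K F, of y x]
        by (auto simp: add.commute)
      with xy show "x + y \<in> ?S"
        by (auto intro: convex_cone_hull_add)
    next
      fix x and c :: real assume xc: "x \<in> ?S" "0 \<le> c"
      show "c *\<^sub>R x \<in> ?S"
      \<comment> \<open>With \<open>c = 0\<close> the multiple lies in \<open>F\<close> whatever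
        \<open>x\<close> is, so membership cannot be pulled back to \<open>x\<close>.\<close>
      proof (cases "c = 0")
        case True
        then show ?thesis by (simp add: convex_cone_hull_contains_0)
      next
        case False
        with xc have "x \<in> F" if "c *\<^sub>R x \<in> F"
          using that cone_face_scaleR[OF K F, of c x] by simp
        with xc show ?thesis by (auto intro: convex_cone_hull_mul)
      qed
    qed
  qed
  moreover have "F \<subseteq> ?K"
    using F face_of_imp_subset unfolding cone_face_def by blast
  ultimately show ?thesis by blast
qed

section \<open>Hilbert bases\<close>

lemma pointed_cone_add_eq_0:
  assumes "pointed_cone K" "x \<in> K" "y \<in> K" "x + y = 0"
  shows "x = 0"
proof -
  have "x = - y" using assms(4) by (simp add: eq_neg_iff_add_eq_0)
  then have "x \<in> K \<inter> uminus ` K" using assms(2,3) by blast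
  then show ?thesis using assms(1) unfolding pointed_cone_def by simp
qed

lemma common_denominator:
  assumes "finite I" "\<And>i. i \<in> I \<Longrightarrow> (f i :: real) \<in> \<rat>"
  shows "\<exists>N::nat. N > 0 \<and> (\<forall>i\<in>I. real N * f i \<in> \<int>)"
  using assms
proof (induction I rule: finite_induct)
  case empty
  then show ?case by (auto intro: exI[of _ 1])
next
  case (insert j I)
  then obtain N :: nat where N: "N > 0" "\<forall>i\<in>I. real N * f i \<in> \<int>" by auto
  from insert.prems[of j] obtain m n where mn: "f j = of_int m / real n" "n \<noteq> 0"
    by (auto simp: Rats_eq_int_div_nat)
  have "real (N * n) * f i \<in> \<int>" if "i \<in> insert j I" for i
  proof (cases "i = j")
    case True
    then have "real (N * n) * f i = real N * of_int m" using mn by (simp del: of_int_mult)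
    then show ?thesis by (metis Ints_mult Ints_of_int Ints_of_nat)
  next
    case False
    have "real (N * n) * f i = real n * (real N * f i)" by simp
    with False that N show ?thesis by (metis Ints_mult Ints_of_nat insertE)
  qed
  moreover have "N * n > 0" using N mn by simp
  ultimately show ?case by blast
qed

text \<open>Clearing the denominators of a rational generator moves it along its ray to an integer
  point.\<close>

lemma rational_cone_hull_int_points:
  assumes "rational_polyhedral_cone K"
  shows "convex_cone hull (K \<inter> int_points) = K"
proof -
  obtain V where V: "\<forall>v\<in>V. \<forall>i. v $ i \<in> \<rat>" "K = convex_cone hull V"
    using assms unfolding rational_polyhedral_cone_def by blast
  have K: "convex_cone K"
    unfolding V by (rule convex_cone_convex_cone_hull)
  show ?thesis
  proof (rule subset_antisym)
    show "convex_cone hull (K \<inter> int_points) \<subseteq> K"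
      using K by (intro hull_minimal) auto
    have "V \<subseteq> convex_cone hull (K \<inter> int_points)"
    proof
      fix v assume v: "v \<in> V"
      then obtain N :: nat where N: "N > 0" "\<forall>i. real N * v $ i \<in> \<int>"
        using V common_denominator[of UNIV "\<lambda>i. v $ i"] by auto
      have "real N *\<^sub>R v \<in> K \<inter> int_points"
        using N v K V by (auto simp: int_points_def intro: convex_cone_hull_mul hull_inc)
      from convex_cone_hull_mul[OF hull_inc[OF this], of "inverse (real N)"]
      show "v \<in> convex_cone hull (K \<inter> int_points)" using N by simp
    qed
    then show "K \<subseteq> convex_cone hull (K \<inter> int_points)"
      unfolding V(2) by (intro hull_minimal convex_cone_convex_cone_hull)
  qed
qed

lemma semigroup_gen_subset_cone_hull: "semigroup_gen A \<subseteq> convex_cone hull A"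
  by (intro semigroup_gen_subset hull_subset convex_cone_hull_contains_0 convex_cone_hull_add)

lemma hilbert_basis_cone_hull:
  assumes "rational_polyhedral_cone K" "is_hilbert_basis K B"
  shows "convex_cone hull B = K"
proof (rule subset_antisym)
  have K: "convex_cone K"
    using assms(1) convex_cone_convex_cone_hull unfolding rational_polyhedral_cone_def by blast
  show "convex_cone hull B \<subseteq> K"
    using assms(2) K unfolding is_hilbert_basis_def by (intro hull_minimal) auto
  have "K \<inter> int_points \<subseteq> convex_cone hull B"
    using assms(2) semigroup_gen_subset_cone_hull unfolding is_hilbert_basis_def by blast
  then have "convex_cone hull (K \<inter> int_points) \<subseteq> convex_cone hull B"
    by (intro hull_minimal convex_cone_convex_cone_hull)
  then show "K \<subseteq> convex_cone hull B"
    using rational_cone_hull_int_points[OF assms(1)] by simp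
qed

text \<open>Otherwise \<open>B - {b}\<close> would generate the same semigroup, against
  minimality.\<close>

lemma hilbert_basis_not_generated:
  assumes "is_hilbert_basis K B" "b \<in> B"
  shows "b \<notin> semigroup_gen (B - {b})"
proof
  assume b: "b \<in> semigroup_gen (B - {b})"
  let ?C = "B - {b}"
  have fin: "finite B"
    using assms(1) unfolding is_hilbert_basis_def by blast
  have "B \<subseteq> semigroup_gen ?C"
    using b fin by (auto intro: semigroup_gen_inc)
  then have "semigroup_gen B \<subseteq> semigroup_gen ?C"
    by (intro semigroup_gen_subset zero_in_semigroup_gen semigroup_gen_add)
  moreover have "semigroup_gen ?C \<subseteq> semigroup_gen B"
    using fin by (intro semigroup_gen_subset zero_in_semigroup_gen semigroup_gen_add)
      (auto intro: semigroup_gen_inc)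
  ultimately have "semigroup_gen ?C = K \<inter> int_points"
    using assms(1) unfolding is_hilbert_basis_def by blast
  moreover have "?C \<subset> B"
    using assms(2) by blast
  ultimately show False
    using assms(1) unfolding is_hilbert_basis_def by blast
qed

lemma hilbert_basis_nonzero:
  assumes "is_hilbert_basis K B" "b \<in> B"
  shows "b \<noteq> 0"
  using hilbert_basis_not_generated[OF assms] zero_in_semigroup_gen by blast

lemma semigroup_gen_split:
  assumes "finite B" "b \<in> B" "x \<in> semigroup_gen B"
  shows "x \<in> semigroup_gen (B - {b}) \<or> (\<exists>r\<in>semigroup_gen B. x = b + r)"
proof -
  from assms(3) obtain c :: "_ \<Rightarrow> nat" where c: "x = (\<Sum>a\<in>B. real (c a) *\<^sub>R a)"
    unfolding semigroup_gen_def by auto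
  then have x: "x = real (c b) *\<^sub>R b + (\<Sum>a\<in>B-{b}. real (c a) *\<^sub>R a)"
    using assms by (simp add: sum.remove)
  have r: "(\<Sum>a\<in>B-{b}. real (c a) *\<^sub>R a) \<in> semigroup_gen (B - {b})"
    by (rule semigroup_genI) (rule refl)
  show ?thesis
  proof (cases "c b")
    case 0
    then show ?thesis using x r by simp
  next
    case (Suc n)
    let ?d = "c(b := n)"
    have "(\<Sum>a\<in>B. real (?d a) *\<^sub>R a) = real n *\<^sub>R b + (\<Sum>a\<in>B-{b}. real (c a) *\<^sub>R a)"
      using assms by (simp add: sum.remove)
    then have "x = b + (\<Sum>a\<in>B. real (?d a) *\<^sub>R a)"
      using x Suc by (simp add: scaleR_add_left algebra_simps)
    moreover have "(\<Sum>a\<in>B. real (?d a) *\<^sub>R a) \<in> semigroup_gen B"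
      by (rule semigroup_genI) (rule refl)
    ultimately show ?thesis by blast
  qed
qed

text \<open>Since \<open>b\<close> is not generated by the other basis elements, one summand must
  use \<open>b\<close> itself. What remains then sums to \<open>0\<close>, and pointedness makes the
  other summand vanish.\<close>

lemma hilbert_basis_irreducible:
  assumes K: "convex_cone K" "pointed_cone K" and B: "is_hilbert_basis K B" "b \<in> B"
    and x: "x \<in> K \<inter> int_points" and y: "y \<in> K \<inter> int_points" and b: "b = x + y"
  shows "x = 0 \<or> y = 0"
proof -
  have fin: "finite B" and gen: "semigroup_gen B = K \<inter> int_points"
    using B unfolding is_hilbert_basis_def by auto
  have cancel: "v = 0"
    if uv: "u \<in> K \<inter> int_points" "v \<in> K \<inter> int_points" "b = u + v"
      and r: "r \<in> semigroup_gen B" "u = b + r" for u v r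
  proof (rule pointed_cone_add_eq_0[OF K(2)])
    show "v \<in> K" "r \<in> K" using uv(2) r(1) gen by auto
    from uv(3) have "b = b + (v + r)"
      unfolding r(2) by (simp only: add_ac)
    then show "v + r = 0"
      by (simp only: add_cancel_right_right)
  qed
  have "\<not> (x \<in> semigroup_gen (B - {b}) \<and> y \<in> semigroup_gen (B - {b}))"
    using hilbert_basis_not_generated[OF B] semigroup_gen_add[of x "B - {b}" y]
    unfolding b[symmetric] by blast
  then consider r where "r \<in> semigroup_gen B" "x = b + r"
    | r where "r \<in> semigroup_gen B" "y = b + r"
    using semigroup_gen_split[OF fin B(2), of x] semigroup_gen_split[OF fin B(2), of y] x y
    unfolding gen by blast
  then show ?thesis
  proof cases
    case 1
    then show ?thesis using cancel[OF x y b] by blast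
  next
    case 2
    moreover have "b = y + x"
      using b by (rule trans[OF _ add.commute])
    ultimately show ?thesis using cancel[OF y x] by blast
  qed
qed

section \<open>Almost saturated faces\<close>

text \<open>The multiple \<open>card B\<close> provides one copy of \<open>s\<close> per basis
  element, enough to absorb each odd coefficient independently.\<close>

lemma saturation_point_card_scaleR:
  assumes B: "is_hilbert_basis K B" and A: "finite A"
    and dbl: "\<And>b. b \<in> B \<Longrightarrow> 2 *\<^sub>R b \<in> A"
    and shifted: "\<And>b. b \<in> B \<union> {0} \<Longrightarrow> s + b \<in> A"
  shows "saturation_point K A (real (card B) *\<^sub>R s)"
  unfolding saturation_point_def
proof
  have s: "s \<in> semigroup_gen A"
    using shifted[of 0] A by (auto intro: semigroup_gen_inc)
  then show "real (card B) *\<^sub>R s \<in> semigroup_gen A"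
    by (intro scaleR_of_nat_closed zero_in_semigroup_gen semigroup_gen_add)
  show "\<forall>q\<in>K \<inter> int_points. real (card B) *\<^sub>R s + q \<in> semigroup_gen A"
  proof
    fix q assume "q \<in> K \<inter> int_points"
    then have "q \<in> semigroup_gen B"
      using B unfolding is_hilbert_basis_def by blast
    then obtain c :: "_ \<Rightarrow> nat" where q: "q = (\<Sum>b\<in>B. real (c b) *\<^sub>R b)"
      unfolding semigroup_gen_def by auto
    have split: "real (c b) *\<^sub>R b = real (c b div 2) *\<^sub>R (2 *\<^sub>R b) + real (c b mod 2) *\<^sub>R b" for b
    proof -
      have "real (c b) = real (c b div 2 * 2 + c b mod 2)"
        by (simp only: div_mult_mod_eq)
      then have "real (c b) = real (c b div 2) * 2 + real (c b mod 2)"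
        by (simp only: of_nat_add of_nat_mult of_nat_numeral)
      then show ?thesis
        by (metis scaleR_add_left scaleR_scaleR)
    qed
    have "real (card B) *\<^sub>R s + q = (\<Sum>b\<in>B. s + real (c b) *\<^sub>R b)"
      unfolding q by (simp only: sum.distrib sum_constant_scaleR)
    also have "\<dots> = (\<Sum>b\<in>B. real (c b div 2) *\<^sub>R (2 *\<^sub>R b) + (s + real (c b mod 2) *\<^sub>R b))"
      by (intro sum.cong refl) (simp only: split add_ac)
    also have "\<dots> \<in> semigroup_gen A"
    proof (rule sum_closed[OF zero_in_semigroup_gen semigroup_gen_add])
      fix b assume b: "b \<in> B"
      have "real (c b div 2) *\<^sub>R (2 *\<^sub>R b) \<in> semigroup_gen A"
        using semigroup_gen_inc[OF A dbl[OF b]]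
        by (intro scaleR_of_nat_closed[OF zero_in_semigroup_gen semigroup_gen_add])
      \<comment> \<open>The remainder is 0 or 1; an even coefficient uses the generator
        \<open>s + 0\<close>, an odd one \<open>s + b\<close>.\<close>
      moreover have "real (c b mod 2) *\<^sub>R b \<in> B \<union> {0}"
        using b by (cases "c b mod 2 = 0") (auto simp: not_mod_2_eq_0_eq_1)
      then have "s + real (c b mod 2) *\<^sub>R b \<in> semigroup_gen A"
        using semigroup_gen_inc[OF A shifted] by blast
      ultimately show "real (c b div 2) *\<^sub>R (2 *\<^sub>R b) + (s + real (c b mod 2) *\<^sub>R b)
          \<in> semigroup_gen A"
        by (rule semigroup_gen_add)
    qed
    finally show "real (card B) *\<^sub>R s + q \<in> semigroup_gen A" .
  qed
qed

text \<open>Serves both directions of the classification: it supplies an \<open>F i\<close> inside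
  any minimal face, and with the antichain condition it excludes almost saturated faces strictly
  below an \<open>F i\<close>.\<close>

lemma almost_saturated_contains_some_face:
  assumes K: "convex_cone K" "pointed_cone K"
    and cone: "convex_cone hull B = K" and B: "is_hilbert_basis K B"
    and I: "I \<noteq> {}" and F: "\<And>i. i \<in> I \<Longrightarrow> cone_face K (F i)"
    and A: "A = {2 *\<^sub>R b | b. b \<in> B} \<union>
                {2 *\<^sub>R (\<Sum>b\<in>B \<inter> F i. b) + b | i b. i \<in> I \<and> b \<in> B \<union> {0}}"
    and fin: "finite A"
    and G: "almost_saturated K A G"
  shows "\<exists>i\<in>I. F i \<subseteq> G"
proof (rule ccontr)
  assume no_face: "\<not> (\<exists>i\<in>I. F i \<subseteq> G)"
  define Q where "Q = K \<inter> int_points"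
  define s where "s i = (\<Sum>b\<in>B \<inter> F i. b)" for i
  have finB: "finite B" and BQ: "B \<subseteq> Q"
    using B unfolding is_hilbert_basis_def Q_def by auto
  have Q0: "0 \<in> Q"
    using K by (simp add: Q_def convex_cone_contains_0 zero_in_int_points)
  have Qadd: "x + y \<in> Q" if "x \<in> Q" "y \<in> Q" for x y
    using that K by (auto simp: Q_def int_points_add intro: convex_cone_add)
  obtain a where Gf: "cone_face K G" and aG: "a \<in> G" and sat: "saturation_point K A a"
    using G unfolding almost_saturated_def by blast
  have G0: "0 \<in> G"
    using cone_face_convex_cone[OF K(1) Gf] convex_cone_contains_0 by blast
  have BK: "b \<in> K" if "b \<in> B" for b
    using that BQ by (auto simp: Q_def)
  have face_hull: "H \<subseteq> convex_cone hull (B \<inter> H)" if "cone_face K H" for H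
    using cone_face_hull[of B H] that cone by simp
  have sQ: "s i \<in> Q" for i
    unfolding s_def using BQ Q0 Qadd by (intro sum_closed) auto
  \<comment> \<open>If \<open>s i\<close> were in \<open>G\<close>, so would be each of its
    summands; these generate \<open>F i\<close>.\<close>
  have sG: "s i \<notin> G" if i: "i \<in> I" for i
  proof
    assume "s i \<in> G"
    then have "B \<inter> F i \<subseteq> G"
      using cone_face_sum[OF K(1) Gf, of "B \<inter> F i" _ "\<lambda>b. b"] finB BK
      unfolding s_def by blast
    then have "convex_cone hull (B \<inter> F i) \<subseteq> G"
      using cone_face_convex_cone[OF K(1) Gf] by (intro hull_minimal)
    then show False
      using face_hull[OF F[OF i]] no_face i by blast
  qed
  \<comment> \<open>The bracketing exposes \<open>s i\<close> as a summand, ready for the face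
    property and for irreducibility.\<close>
  have A_cases: "(\<exists>b\<in>B. x = 2 *\<^sub>R b) \<or> (\<exists>i\<in>I. \<exists>y\<in>Q. x = s i + (s i + y))" if "x \<in> A" for x
    using that BQ Q0 unfolding A s_def[symmetric] scaleR_2 by (auto simp: add.assoc)
  have AQ: "A \<subseteq> Q"
  proof
    fix x assume "x \<in> A"
    moreover have "2 *\<^sub>R y \<in> Q" if "y \<in> Q" for y
      unfolding scaleR_2 using that by (intro Qadd)
    ultimately show "x \<in> Q"
      using A_cases[of x] sQ BQ by (blast intro: Qadd)
  qed
  have irred: "u = 0 \<or> v = 0" if "u + v \<in> B" "u \<in> Q" "v \<in> Q" for u v
    using hilbert_basis_irreducible[OF K B] that unfolding Q_def by blast
  have doubles: "\<exists>z\<in>Q. x = 2 *\<^sub>R z" if x: "x \<in> semigroup_gen A" "x \<in> G" for x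
  proof -
    obtain c :: "_ \<Rightarrow> nat" where c: "x = (\<Sum>a\<in>A. real (c a) *\<^sub>R a)"
      using x(1) unfolding semigroup_gen_def by auto
    let ?D = "(\<lambda>z. 2 *\<^sub>R z) ` Q"
    have D0: "0 \<in> ?D" using Q0 by force
    have Dadd: "u + v \<in> ?D" if "u \<in> ?D" "v \<in> ?D" for u v
      using that Qadd by (auto simp flip: scaleR_add_right)
    have "real (c a) *\<^sub>R a \<in> ?D" if a: "a \<in> A" for a
    \<comment> \<open>Generators with coefficient 0 may lie outside \<open>G\<close>; only the
      others inherit membership from \<open>x\<close>.\<close>
    proof (cases "c a = 0")
      case True
      then show ?thesis using D0 by simp
    next
      case False
      have "real (c a) *\<^sub>R a \<in> G"
        using x(2) fin a AQ K(1) unfolding c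
        by (intro cone_face_sum[OF K(1) Gf, of A a "\<lambda>a. real (c a) *\<^sub>R a"])
          (auto simp: Q_def intro: convex_cone_scaleR)
      then have "a \<in> G"
        using False cone_face_scaleR[OF K(1) Gf, of "real (c a)" a] by simp
      \<comment> \<open>A shifted generator in \<open>G\<close> would drag \<open>s i\<close> into
        \<open>G\<close>, so only the generators \<open>2 *\<^sub>R b\<close> remain.\<close>
      moreover have "a \<notin> G" if "i \<in> I" "y \<in> Q" "a = s i + (s i + y)" for i y
        using that cone_face_add[OF K(1) Gf, of "s i" "s i + y"] sG sQ Qadd
        unfolding Q_def by blast
      ultimately have "a \<in> ?D"
        using A_cases[OF a] BQ by blast
      then show ?thesis
        by (intro scaleR_of_nat_closed D0 Dadd)
    qed
    then have "x \<in> ?D"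
      unfolding c by (intro sum_closed D0 Dadd)
    then show ?thesis by blast
  qed
  show False
  proof (cases "B \<inter> G = {}")
    case False
    then obtain b where b: "b \<in> B" "b \<in> G" by blast
    obtain z where z: "z \<in> Q" "a = 2 *\<^sub>R z"
      using doubles[of a] aG sat unfolding saturation_point_def by blast
    have "a + b \<in> semigroup_gen A"
      using sat b BQ unfolding saturation_point_def Q_def by blast
    moreover have "a + b \<in> G"
      using cone_face_convex_cone[OF K(1) Gf] aG b by (intro convex_cone_add)
    ultimately obtain w where w: "w \<in> Q" "a + b = 2 *\<^sub>R w"
      using doubles by blast
    \<comment> \<open>As half of \<open>b\<close>, this point lies in \<open>K\<close>; as
      \<open>w - z\<close>, it is integral. Hence \<open>b = h + h\<close> is a forbidden
      decomposition.\<close>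
    define h where "h = (1/2) *\<^sub>R b"
    have hb: "h + h = b"
      unfolding h_def by (metis scaleR_add_right scaleR_half_double)
    have "b = 2 *\<^sub>R (w - z)"
      using z(2) w(2) by (metis add_diff_cancel_left' scaleR_right_diff_distrib)
    then have "h = w - z"
      by (simp add: h_def)
    then have "h \<in> int_points"
      using z w by (auto simp: Q_def int_points_def)
    moreover have "h \<in> K"
      using BK[OF b(1)] K(1) by (auto simp: h_def intro: convex_cone_scaleR)
    ultimately have "h = 0"
      using irred[of h h] hb b(1) unfolding Q_def by blast
    then show False
      using hb hilbert_basis_nonzero[OF B b(1)] by simp
  next
    case True
    then have "G = {0}"
      using face_hull[OF Gf] G0 by auto
    then have a0: "a = 0" and s0: "s i \<noteq> 0" if "i \<in> I" for i
      using aG sG[of i] that by auto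
    obtain i where i: "i \<in> I" using I by blast
    \<comment> \<open>This yields a basis element: an empty \<open>B \<inter> F i\<close> would
      generate only \<open>{0}\<close>, but \<open>F i\<close> is not contained in
      \<open>G = {0}\<close>.\<close>
    have "F i \<noteq> {0}" "F i \<noteq> {}"
      using no_face i G0 by auto
    then have "B \<inter> F i \<noteq> {}"
      using face_hull[OF F[OF i]] by auto
    then obtain b where b: "b \<in> B" by blast
    then have "b \<in> semigroup_gen A"
      using sat BQ a0[OF i] unfolding saturation_point_def Q_def by auto
    then obtain x where x: "x \<in> A" "x \<noteq> 0" and "\<exists>r\<in>semigroup_gen A. b = x + r"
    proof -
      obtain c :: "_ \<Rightarrow> nat" where c: "b = (\<Sum>a\<in>A. real (c a) *\<^sub>R a)"
        using \<open>b \<in> semigroup_gen A\<close> unfolding semigroup_gen_def by auto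
      \<comment> \<open>As \<open>b\<close> is nonzero, some term is nonzero, and one copy of its
        generator can be split off.\<close>
      have "\<not> (\<forall>x\<in>A. real (c x) *\<^sub>R x = 0)"
        using hilbert_basis_nonzero[OF B b] c by (metis (no_types, lifting) sum.neutral)
      then obtain x where x: "x \<in> A" "x \<noteq> 0" "c x \<noteq> 0" by auto
      then obtain n where n: "c x = Suc n" by (metis not0_implies_Suc)
      have "b = x + (real n *\<^sub>R x + (\<Sum>a\<in>A - {x}. real (c a) *\<^sub>R a))"
        unfolding c using fin x(1) n by (simp add: sum.remove scaleR_add_left)
      moreover have "real n *\<^sub>R x + (\<Sum>a\<in>A - {x}. real (c a) *\<^sub>R a) \<in> semigroup_gen A"
        using fin x(1) by (intro semigroup_gen_add sum_closed scaleR_of_nat_closed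
            zero_in_semigroup_gen) (auto intro: semigroup_gen_inc)
      ultimately show ?thesis using that x by blast
    qed
    then obtain r where r: "r \<in> Q" "b = x + r"
      using semigroup_gen_subset[OF AQ Q0 Qadd] by blast
    \<comment> \<open>Each generator contains a nonzero summand twice: a basis element, or
      \<open>s i\<close>, which is nonzero because it is not in \<open>G\<close>.\<close>
    have "\<exists>u\<in>Q. \<exists>v\<in>Q. u \<noteq> 0 \<and> x = u + (u + v)"
      using A_cases[OF x(1)]
    proof
      assume "\<exists>b\<in>B. x = 2 *\<^sub>R b"
      then obtain b' where "b' \<in> B" "x = b' + (b' + 0)" by (auto simp: scaleR_2)
      then show ?thesis using BQ Q0 hilbert_basis_nonzero[OF B] by blast
    next
      assume "\<exists>i\<in>I. \<exists>y\<in>Q. x = s i + (s i + y)"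
      then show ?thesis using s0 sQ by blast
    qed
    then obtain u v where uv: "u \<in> Q" "v \<in> Q" "u \<noteq> 0" "x = u + (u + v)" by blast
    \<comment> \<open>This is \<open>b\<close> itself. Irreducibility and
      \<open>u \<noteq> 0\<close> leave \<open>u + (v + r) = 0\<close>, and pointedness then
      contradicts \<open>u \<noteq> 0\<close>.\<close>
    have "u + (u + (v + r)) \<in> B"
      using b r uv by (simp add: add.assoc)
    then have "u + (v + r) = 0"
      using irred[of u "u + (v + r)"] uv r Qadd by blast
    then show False
      using pointed_cone_add_eq_0[OF K(2), of u "v + r"] uv r Qadd by (auto simp: Q_def)
  qed
qed

theorem theorem4p1:
  fixes K B A :: "(real ^ 'n) set"
    and F :: "nat \<Rightarrow> (real ^ 'n) set"
    and bstar :: "nat \<Rightarrow> real ^ 'n"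
    and M :: nat
  assumes "rational_polyhedral_cone K"
    and "pointed_cone K"
    and "interior K \<noteq> {}"
    and "is_hilbert_basis K B"
    and "M \<ge> 1"
    and "antichain_of_faces K (F ` {1..M})"
    and "\<And>i. i \<in> {1..M} \<Longrightarrow> bstar i = (\<Sum>b\<in>B \<inter> F i. b)"
    and "A = {2 *\<^sub>R b | b. b \<in> B} \<union>
             {2 *\<^sub>R bstar i + b | i b. i \<in> {1..M} \<and> b \<in> B \<union> {0}}"
  shows "convex_cone hull A = K
       \<and> semigroup_saturation A = K \<inter> int_points
       \<and> {G. minimal_almost_saturated K A G} = F ` {1..M}"
proof -
  define I where "I = {1..M}"
  define s where "s i = (\<Sum>b\<in>B \<inter> F i. b)" for i
  have I: "I \<noteq> {}" "finite I" using assms(5) by (auto simp: I_def)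
  have B: "is_hilbert_basis K B" by fact
  have K: "convex_cone K"
    using assms(1) convex_cone_convex_cone_hull unfolding rational_polyhedral_cone_def by blast
  have cone: "convex_cone hull B = K"
    using assms(1,4) by (rule hilbert_basis_cone_hull)
  have F: "cone_face K (F i)" if "i \<in> I" for i
    using assms(6) that unfolding antichain_of_faces_def I_def by blast
  have anti: "F i = F j" if "i \<in> I" "j \<in> I" "F i \<subseteq> F j" for i j
    using assms(6) that unfolding antichain_of_faces_def I_def by blast
  have bstar: "bstar i = s i" if "i \<in> I" for i
    using assms(7) that unfolding s_def I_def by blast
  have A: "A = {2 *\<^sub>R b | b. b \<in> B} \<union> {2 *\<^sub>R s i + b | i b. i \<in> I \<and> b \<in> B \<union> {0}}"
    unfolding assms(8) I_def[symmetric]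
    by (intro arg_cong2[where f = "(\<union>)"] refl Collect_cong iff_exI) (auto simp only: bstar)
  have finB: "finite B" and gen: "semigroup_gen B = K \<inter> int_points"
    and BQ: "B \<subseteq> K \<inter> int_points"
    using B unfolding is_hilbert_basis_def by auto
  have finA: "finite A"
    unfolding A using finB I by (intro finite_UnI finite_image_set finite_image_set2) auto
  have dbl: "2 *\<^sub>R b \<in> A" if "b \<in> B" for b
    using that unfolding A by blast
  have shifted: "2 *\<^sub>R s i + b \<in> A" if "i \<in> I" "b \<in> B \<union> {0}" for i b
    using that unfolding A by blast
  have s_gen: "s i \<in> semigroup_gen B" for i
    unfolding s_def using finB
    by (intro sum_closed zero_in_semigroup_gen semigroup_gen_add) (auto intro: semigroup_gen_inc)
  have AQ: "A \<subseteq> K \<inter> int_points"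
  proof -
    have double: "2 *\<^sub>R x \<in> semigroup_gen B" if "x \<in> semigroup_gen B" for x
      unfolding scaleR_2 using that by (intro semigroup_gen_add)
    have "B \<subseteq> semigroup_gen B"
      using finB by (auto intro: semigroup_gen_inc)
    then show ?thesis
      unfolding A gen[symmetric] using s_gen
      by (auto intro!: semigroup_gen_add double zero_in_semigroup_gen)
  qed

  \<comment> \<open>The cone generated by \<open>A\<close>\<close>
  have cone_A: "convex_cone hull A = K"
  proof (rule subset_antisym)
    show "convex_cone hull A \<subseteq> K"
      using AQ K by (intro hull_minimal) auto
    have "b \<in> convex_cone hull A" if "b \<in> B" for b
      using convex_cone_hull_mul[OF hull_inc[OF dbl[OF that]], of "1/2"] by simp
    then show "K \<subseteq> convex_cone hull A"
      unfolding cone[symmetric] by (intro hull_minimal convex_cone_convex_cone_hull subsetI)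
  qed

  \<comment> \<open>The lattice generated by \<open>A\<close> and the saturation\<close>
  have "K \<inter> int_points \<subseteq> lattice_gen A"
    unfolding gen[symmetric]
  proof (intro semigroup_gen_subset subsetI lattice_gen_add)
    show "0 \<in> lattice_gen A"
      using zero_in_semigroup_gen semigroup_gen_subset_lattice_gen by blast
    \<comment> \<open>One face suffices: every \<open>b\<close> is the difference of two generators
      with the same shift \<open>2 *\<^sub>R s i\<close>.\<close>
    obtain i where i: "i \<in> I" using I by blast
    fix b assume "b \<in> B"
    then have "2 *\<^sub>R s i + b \<in> lattice_gen A" "2 *\<^sub>R s i + 0 \<in> lattice_gen A"
      using shifted[OF i] finA semigroup_gen_inc semigroup_gen_subset_lattice_gen by blast+
    then have "(2 *\<^sub>R s i + b) - (2 *\<^sub>R s i + 0) \<in> lattice_gen A"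
      by (rule lattice_gen_diff)
    then show "b \<in> lattice_gen A" by simp
  qed
  moreover have "lattice_gen A \<subseteq> int_points"
    using AQ by (intro lattice_gen_subset_int_points) auto
  ultimately have saturation: "semigroup_saturation A = K \<inter> int_points"
    unfolding semigroup_saturation_def cone_A by blast

  \<comment> \<open>Classification of the minimal almost saturated faces\<close>
  have F_sat: "almost_saturated K A (F i)" if i: "i \<in> I" for i
    unfolding almost_saturated_def
  proof (intro conjI bexI F i)
    show "saturation_point K A (real (card B) *\<^sub>R (2 *\<^sub>R s i))"
      using dbl shifted[OF i] by (intro saturation_point_card_scaleR[OF B finA])
    have cF: "convex_cone (F i)"
      using K F[OF i] by (rule cone_face_convex_cone)
    then have "s i \<in> F i"
      unfolding s_def by (intro sum_closed) (auto intro: convex_cone_contains_0 convex_cone_add)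
    then show "real (card B) *\<^sub>R (2 *\<^sub>R s i) \<in> F i"
      using cF by (intro convex_cone_scaleR) auto
  qed
  have contains: "\<exists>i\<in>I. F i \<subseteq> G" if "almost_saturated K A G" for G
    using almost_saturated_contains_some_face[OF K assms(2) cone B I(1) F A[unfolded s_def] finA that]
    by blast
  have "minimal_almost_saturated K A G \<longleftrightarrow> G \<in> F ` I" for G
  proof
    assume G: "minimal_almost_saturated K A G"
    then obtain i where i: "i \<in> I" "F i \<subseteq> G"
      using contains unfolding minimal_almost_saturated_def by blast
    then have "\<not> F i \<subset> G"
      using G F F_sat unfolding minimal_almost_saturated_def by blast
    then show "G \<in> F ` I" using i by blast
  next
    assume "G \<in> F ` I"
    then obtain i where i: "i \<in> I" "G = F i" by blast
    \<comment> \<open>Such an \<open>H\<close> would contain some \<open>F j\<close>; the antichain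
      condition gives \<open>F j = F i\<close>, which does not fit inside \<open>H\<close>.\<close>
    have "\<not> almost_saturated K A H" if "H \<subset> F i" for H
      using contains[of H] anti i(1) that by blast
    then show "minimal_almost_saturated K A G"
      using F_sat i unfolding minimal_almost_saturated_def by blast
  qed
  then show ?thesis
    using cone_A saturation unfolding I_def by blast
qed

end
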